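(* Let $m\in\mathbb{N}$, $k\in\mathbb{N}$, and let $n_1,\dots,n_m\in\mathbb{N}$ with $n_i\ge 2$ for $1\le i\le m$. The disjoint union of paths $\bigcup_{i=1}^m P_{n_i}$ is $k$-distance magic if and only if $n_i=3$ (for all $i$) and $m=1=k$.
   Context: All graphs are finite, simple and undirected; $d(u,v)$ is graph distance ($\infty$ between different components). For $u\in V(G)$ and $k\in\mathbb{N}$, $\partial N_k(u)=\{v\in V(G): d(u,v)=k\}$. For a graph $G$ of order $n\ge3$, a $k$-distance magic labeling ($k$-DML) is a bijection $f:V(G)\to\{1,\dots,n\}$ together with a constant $M$ such that $\sum_{w\in\partial N_k(u)} f(w)=M$ for every vertex $u$ with $\partial N_k(u)\neq\emptyset$; moreover $G$ is required to contain at least one pair of vertices at distance $k$. $G$ is $k$-distance magic ($k$-DM) if it has a $k$-DML. *)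

theory Defs
  imports "Graph_Theory.Pair_Digraph" "Graph_Theory.Shortest_Path"
begin

text \<open>
  A finite simple undirected graph is a \<open>pair_graph\<close>: each edge \<open>uv\<close> is stored as the
  two arcs \<open>(u, v)\<close> and \<open>(v, u)\<close>.
\<close>

text \<open>Unit arc weights turn the library's shortest-path cost into the graph distance; it is
  \<open>\<infinity>\<close> between different components.\<close>

definition graph_dist :: "'a pair_pre_digraph \<Rightarrow> 'a \<Rightarrow> 'a \<Rightarrow> ereal" where
  "graph_dist G u v = wf_digraph.\<mu> (with_proj G) (\<lambda>_. 1) u v"

lemma (in pair_wf_digraph) graph_dist_conv_walk_length:
  "graph_dist G u v = (INF p\<in>{p. awalk u p v}. ereal (real (length p)))"
  by (simp add: graph_dist_def \<mu>_def awalk_cost_def sum_list_triv)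

definition dist_nbhd :: "'a pair_pre_digraph \<Rightarrow> nat \<Rightarrow> 'a \<Rightarrow> 'a set" where
  "dist_nbhd G k u = {v \<in> pverts G. graph_dist G u v = ereal (real k)}"

definition k_distance_magic_labeling ::
    "nat \<Rightarrow> 'a pair_pre_digraph \<Rightarrow> ('a \<Rightarrow> nat) \<Rightarrow> nat \<Rightarrow> bool" where
  "k_distance_magic_labeling k G f M \<longleftrightarrow>
     card (pverts G) \<ge> 3 \<and>
     (\<exists>u\<in>pverts G. \<exists>v\<in>pverts G. graph_dist G u v = ereal (real k)) \<and>
     bij_betw f (pverts G) {1..card (pverts G)} \<and>
     (\<forall>u\<in>pverts G. dist_nbhd G k u \<noteq> {} \<longrightarrow> (\<Sum>w\<in>dist_nbhd G k u. f w) = M)"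

definition k_distance_magic :: "nat \<Rightarrow> 'a pair_pre_digraph \<Rightarrow> bool" where
  "k_distance_magic k G \<longleftrightarrow> (\<exists>f M. k_distance_magic_labeling k G f M)"

definition path_graph :: "nat \<Rightarrow> nat pair_pre_digraph" where
  "path_graph n = \<lparr> pverts = {1..n},
     parcs = {(u, v). u \<in> {1..n} \<and> v \<in> {1..n} \<and> (v = Suc u \<or> u = Suc v)} \<rparr>"

definition disjoint_union :: "'i set \<Rightarrow> ('i \<Rightarrow> 'a pair_pre_digraph) \<Rightarrow> ('i \<times> 'a) pair_pre_digraph" where
  "disjoint_union I H = \<lparr> pverts = (SIGMA i:I. pverts (H i)),
     parcs = {((i, u), (i, v)) |i u v. i \<in> I \<and> (u, v) \<in> parcs (H i)} \<rparr>"

lemma pair_graph_path_graph: "pair_graph (path_graph n)"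
proof
  show "finite (parcs (path_graph n))"
    by (rule finite_subset[of _ "{1..n} \<times> {1..n}"]) (auto simp: path_graph_def)
  show "symmetric (with_proj (path_graph n))"
    by (auto simp: symmetric_def sym_def path_graph_def)
qed (auto simp: path_graph_def)

lemma pair_graph_disjoint_union:
  assumes "finite I" and graph: "\<And>i. i \<in> I \<Longrightarrow> pair_graph (H i)"
  shows "pair_graph (disjoint_union I H)"
proof -
  let ?U = "disjoint_union I H"
  have verts: "pverts ?U = (SIGMA i:I. pverts (H i))"
    by (simp add: disjoint_union_def)
  have arc: "\<exists>i u v. e = ((i, u), (i, v)) \<and> i \<in> I \<and> u \<in> pverts (H i) \<and> v \<in> pverts (H i)
      \<and> u \<noteq> v \<and> ((i, v), (i, u)) \<in> parcs ?U" if "e \<in> parcs ?U" for e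
  proof -
    from that obtain i u v where e: "e = ((i, u), (i, v))" and i: "i \<in> I"
      and uv: "(u, v) \<in> parcs (H i)"
      unfolding disjoint_union_def by auto
    interpret pair_graph "H i" using graph i .
    have "(v, u) \<in> parcs (H i)"
      using pair_sym_arcs uv by (simp add: symmetric_def sym_def)
    then show ?thesis
      using e i in_arcsD1[OF uv] in_arcsD2[OF uv] no_loops'[OF uv]
      by (simp add: disjoint_union_def)
  qed
  have "finite (pverts (H i))" if "i \<in> I" for i
  proof -
    interpret pair_graph "H i" using graph that .
    show ?thesis by (rule pair_finite_verts)
  qed
  then have fin: "finite (pverts ?U)"
    using \<open>finite I\<close> unfolding verts by (rule finite_SigmaI[rotated])
  show ?thesis
  proof
    fix e assume "e \<in> parcs ?U"
    from arc[OF this] show "fst e \<in> pverts ?U" "snd e \<in> pverts ?U" "fst e \<noteq> snd e"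
      unfolding verts by force+
  next
    have "parcs ?U \<subseteq> pverts ?U \<times> pverts ?U"
      unfolding verts using arc by blast
    then show "finite (parcs ?U)"
      by (rule finite_subset) (intro finite_cartesian_product fin)
  next
    show "symmetric (with_proj ?U)"
      unfolding symmetric_def sym_def with_proj_simps using arc by blast
  qed (rule fin)
qed

end

theory Submission
  imports Defs
begin

text \<open>
  An end vertex of a path has at most one vertex at distance \<open>k\<close>, so in a magic labeling that vertex
  carries the label \<open>M\<close>. Injectivity leaves room for only one such vertex: the two ends of a path
  with more than \<open>k\<close> vertices force it to have \<open>2k + 1\<close> vertices, its second vertex then excludes
  \<open>k \<ge> 2\<close>, and for \<open>k = 1\<close> every further path would contribute a second vertex labeled \<open>M\<close>.
\<close>

abbreviation path_union :: "'i set \<Rightarrow> ('i \<Rightarrow> nat) \<Rightarrow> ('i \<times> nat) pair_pre_digraph" where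
  "path_union I n \<equiv> disjoint_union I (\<lambda>i. path_graph (n i))"

lemma pverts_path_union: "pverts (path_union I n) = (SIGMA i:I. {1..n i})"
  by (simp add: disjoint_union_def path_graph_def)

lemma parcs_path_union_iff:
  "((i, a), (j, b)) \<in> parcs (path_union I n) \<longleftrightarrow>
    j = i \<and> i \<in> I \<and> a \<in> {1..n i} \<and> b \<in> {1..n i} \<and> (b = Suc a \<or> a = Suc b)"
  by (auto simp: disjoint_union_def path_graph_def)

lemma pair_graph_path_union: "finite I \<Longrightarrow> pair_graph (path_union I n)"
  by (intro pair_graph_disjoint_union pair_graph_path_graph)

text \<open>Each arc stays in its component and shifts the position by one, so the claim follows by
  induction along the walk. This is the lower bound on distances.\<close>

lemma path_union_awalk_bound:
  assumes "finite I"
    and "pre_digraph.awalk (with_proj (path_union I n)) x p y"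
  shows "fst x = fst y \<and> \<bar>int (snd x) - int (snd y)\<bar> \<le> int (length p)"
proof -
  interpret pair_graph "path_union I n" using assms(1) by (rule pair_graph_path_union)
  show ?thesis using assms(2)
  proof (induction p arbitrary: x)
    case Nil
    then show ?case by (simp add: awalk_Nil_iff)
  next
    case (Cons e p)
    obtain i a j b where e: "e = ((i, a), (j, b))" by (metis surj_pair)
    from Cons.prems have "((i, a), (j, b)) \<in> parcs (path_union I n)" "x = (i, a)" "awalk (j, b) p y"
      by (auto simp: awalk_Cons_iff e)
    then show ?case
      using Cons.IH[of "(j, b)"] by (auto simp: parcs_path_union_iff)
  qed
qed

text \<open>The monotone walk attains the lower bound. Arcs are prepended, so the induction must let
  the start \<open>a\<close> vary.\<close>

lemma path_union_awalk_up:
  assumes "finite I" "i \<in> I" "1 \<le> a" "a + d \<le> n i"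
  shows "\<exists>p. pre_digraph.awalk (with_proj (path_union I n)) (i, a) p (i, a + d) \<and> length p = d"
proof -
  interpret pair_graph "path_union I n" using assms(1) by (rule pair_graph_path_union)
  show ?thesis using assms(3,4)
  proof (induction d arbitrary: a)
    case 0
    then show ?case
      using assms(2) by (intro exI[of _ "[]"]) (simp add: awalk_Nil_iff pverts_path_union)
  next
    case (Suc d)
    then obtain p where "awalk (i, Suc a) p (i, Suc a + d)" "length p = d"
      using Suc.IH[of "Suc a"] by auto
    moreover have "((i, a), (i, Suc a)) \<in> parcs (path_union I n)"
      using Suc.prems assms(2) by (simp add: parcs_path_union_iff)
    ultimately show ?case
      by (intro exI[of _ "((i, a), (i, Suc a)) # p"]) (simp add: awalk_Cons_iff)
  qed
qed

text \<open>Here the prepended arc moves the start from \<open>a + d\<close> to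
  \<open>a + d + 1\<close> while the end stays put, so \<open>a\<close> can remain fixed.\<close>

lemma path_union_awalk_down:
  assumes "finite I" "i \<in> I" "1 \<le> a" "a + d \<le> n i"
  shows "\<exists>p. pre_digraph.awalk (with_proj (path_union I n)) (i, a + d) p (i, a) \<and> length p = d"
proof -
  interpret pair_graph "path_union I n" using assms(1) by (rule pair_graph_path_union)
  show ?thesis using assms(4)
  proof (induction d)
    case 0
    then show ?case
      using assms by (intro exI[of _ "[]"]) (simp add: awalk_Nil_iff pverts_path_union)
  next
    case (Suc d)
    then obtain p where "awalk (i, a + d) p (i, a)" "length p = d"
      by auto
    moreover have "((i, Suc (a + d)), (i, a + d)) \<in> parcs (path_union I n)"
      using Suc.prems assms(2,3) by (simp add: parcs_path_union_iff)
    ultimately show ?case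
      by (intro exI[of _ "((i, Suc (a + d)), (i, a + d)) # p"]) (simp add: awalk_Cons_iff)
  qed
qed

lemma graph_dist_path_union:
  assumes "finite I" "i \<in> I" "a \<in> {1..n i}" "j \<in> I" "b \<in> {1..n j}"
  shows "graph_dist (path_union I n) (i, a) (j, b) =
    (if i = j then ereal (real_of_int \<bar>int a - int b\<bar>) else \<infinity>)"
proof -
  interpret pair_graph "path_union I n" using assms(1) by (rule pair_graph_path_union)
  note bound = path_union_awalk_bound[OF assms(1), of n "(i, a)" _ "(j, b)"]
  show ?thesis
  proof (cases "i = j")
    case False
    \<comment> \<open>No walk changes component, and the infimum over the empty set is
      \<open>\<infinity>\<close>.\<close>
    then have "{p. awalk (i, a) p (j, b)} = {}" using bound by auto
    then show ?thesis using False by (simp add: graph_dist_conv_walk_length top_ereal_def)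
  next
    case True
    have "\<exists>p. awalk (i, a) p (j, b) \<and> int (length p) = \<bar>int a - int b\<bar>"
    proof (cases "a \<le> b")
      case le: True
      then show ?thesis
        using path_union_awalk_up[of I i a "b - a" n] assms True by auto
    next
      case False
      then show ?thesis
        using path_union_awalk_down[of I i b "a - b" n] assms True by auto
    qed
    then obtain p where p: "awalk (i, a) p (j, b)" "int (length p) = \<bar>int a - int b\<bar>" by blast
    have "graph_dist (path_union I n) (i, a) (j, b) = ereal (real_of_int \<bar>int a - int b\<bar>)"
      unfolding graph_dist_conv_walk_length
    proof (rule antisym)
      show "(INF p\<in>{p. awalk (i, a) p (j, b)}. ereal (real (length p)))
          \<le> ereal (real_of_int \<bar>int a - int b\<bar>)"
        using p by (intro INF_lower2[of p]) (auto simp flip: p(2))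
      show "ereal (real_of_int \<bar>int a - int b\<bar>)
          \<le> (INF p\<in>{p. awalk (i, a) p (j, b)}. ereal (real (length p)))"
      proof (rule INF_greatest)
        fix q assume "q \<in> {p. awalk (i, a) p (j, b)}"
        then have "\<bar>int a - int b\<bar> \<le> int (length q)" using bound[of q] by simp
        then show "ereal (real_of_int \<bar>int a - int b\<bar>) \<le> ereal (real (length q))"
          by (metis ereal_less_eq(3) of_int_le_iff of_int_of_nat_eq)
      qed
    qed
    then show ?thesis using True by simp
  qed
qed

lemma graph_dist_path_union_eq_iff:
  assumes "finite I" "i \<in> I" "a \<in> {1..n i}" "j \<in> I" "b \<in> {1..n j}"
  shows "graph_dist (path_union I n) (i, a) (j, b) = ereal (real k) \<longleftrightarrow>
    i = j \<and> (b = a + k \<or> a = b + k)"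
proof -
  have "real_of_int \<bar>int a - int b\<bar> = real k \<longleftrightarrow> \<bar>int a - int b\<bar> = int k"
    by (metis of_int_eq_iff of_int_of_nat_eq)
  also have "\<dots> \<longleftrightarrow> b = a + k \<or> a = b + k" by auto
  finally show ?thesis by (simp add: graph_dist_path_union[OF assms])
qed

text \<open>Reduces everything below to arithmetic on positions. Writing \<open>a = b + k\<close>
  instead of \<open>b = a - k\<close> avoids truncated subtraction.\<close>

lemma dist_nbhd_path_union:
  assumes "finite I" "i \<in> I" "a \<in> {1..n i}"
  shows "dist_nbhd (path_union I n) k (i, a) =
    {i} \<times> {b \<in> {1..n i}. b = a + k \<or> a = b + k}"
  using assms
  by (auto simp: dist_nbhd_def pverts_path_union graph_dist_path_union_eq_iff)

lemma magic_label_unique_neighbour: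
  assumes "k_distance_magic_labeling k G f M" "u \<in> pverts G" "dist_nbhd G k u = {w}"
  shows "f w = M"
  using assms by (fastforce simp: k_distance_magic_labeling_def)

lemma path_union_magic_imp:
  assumes fin: "finite I" and n2: "\<And>i. i \<in> I \<Longrightarrow> n i \<ge> 2"
    and lab: "k_distance_magic_labeling k (path_union I n) f M"
  shows "k = 1 \<and> (\<exists>i. I = {i} \<and> n i = 3)"
proof -
  let ?G = "path_union I n"
  have inj: "inj_on f (pverts ?G)" and card3: "card (pverts ?G) \<ge> 3"
    using lab by (auto simp: k_distance_magic_labeling_def bij_betw_def)
  have label: "f (i, b) = M \<and> (i, b) \<in> pverts ?G"
    if "i \<in> I" "a \<in> {1..n i}" "{b' \<in> {1..n i}. b' = a + k \<or> a = b' + k} = {b}" for i a b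
  proof
    have "dist_nbhd ?G k (i, a) = {(i, b)}"
      unfolding dist_nbhd_path_union[where n = n, OF fin that(1,2)] that(3) by simp
    then show "f (i, b) = M"
      using that by (intro magic_label_unique_neighbour[OF lab, of "(i, a)"])
        (auto simp: pverts_path_union)
    show "(i, b) \<in> pverts ?G"
      using that by (auto simp: pverts_path_union)
  qed
  \<comment> \<open>Both sole neighbours carry the label \<open>M\<close>, so injectivity of
    \<open>f\<close> identifies them. All later contradictions are instances of this.\<close>
  have eq: "(i, b) = (j, c)"
    if "i \<in> I" "a \<in> {1..n i}" "{b' \<in> {1..n i}. b' = a + k \<or> a = b' + k} = {b}"
      "j \<in> I" "a' \<in> {1..n j}" "{b' \<in> {1..n j}. b' = a' + k \<or> a' = b' + k} = {c}"
    for i j a b a' c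
    using label[OF that(1-3)] label[OF that(4-6)] by (metis inj_onD[OF inj])
  \<comment> \<open>At distance 0 each vertex is its own sole neighbour, so all vertices would
    coincide, against an order of at least 3.\<close>
  have k: "k \<noteq> 0"
  proof
    assume k0: "k = 0"
    have "x = y" if x: "x \<in> pverts ?G" and y: "y \<in> pverts ?G" for x y
    proof -
      obtain i a j c where "x = (i, a)" "y = (j, c)" by (metis surj_pair)
      then show ?thesis using x y k0 eq[of i a a j c c] by (auto simp: pverts_path_union)
    qed
    \<comment> \<open>An infinite set would be harmless here, since its \<open>card\<close> is
      0.\<close>
    then have "card (pverts ?G) \<le> 1"
      by (metis card.infinite card_le_Suc0_iff_eq One_nat_def le0)
    then show False using card3 by simp
  qed
  \<comment> \<open>The pair at distance \<open>k\<close> that a labeling requires provides a path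
    with more than \<open>k\<close> vertices; in particular \<open>I\<close> is nonempty.\<close>
  obtain x y where xy: "x \<in> pverts ?G" "y \<in> pverts ?G" "graph_dist ?G x y = ereal (real k)"
    using lab by (auto simp: k_distance_magic_labeling_def)
  obtain i a j b where "x = (i, a)" "y = (j, b)" by (metis surj_pair)
  then have i: "i \<in> I" and ni: "n i \<ge> k + 1"
    using xy fin by (auto simp: pverts_path_union graph_dist_path_union_eq_iff)
  \<comment> \<open>Stated for every sufficiently long path \<open>j\<close>, because the other
    components are compared with \<open>i\<close> in the same way later.\<close>
  have first: "{b \<in> {1..n j}. b = 1 + k \<or> 1 = b + k} = {1 + k}" if "n j \<ge> k + 1" for j
    using k that by auto
  have last: "{b \<in> {1..n i}. b = n i + k \<or> n i = b + k} = {n i - k}"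
    using k ni by auto
  have "(i, 1 + k) = (i, n i - k)"
    using eq[OF i _ first[OF ni] i _ last] ni by simp
  then have nik: "n i = 2 * k + 1" using ni by auto
  have k1: "k = 1"
  proof (rule ccontr)
    assume "k \<noteq> 1"
    \<comment> \<open>For \<open>k \<ge> 2\<close> nothing lies \<open>k\<close> places before
      vertex 2, while \<open>2 + k \<le> 2 * k + 1\<close> is still on the path. So
      \<open>2 + k\<close> would have to equal \<open>1 + k\<close>.\<close>
    then have "{b \<in> {1..n i}. b = 2 + k \<or> 2 = b + k} = {2 + k}"
      using k nik by auto
    from eq[OF i _ first[OF ni] i _ this] show False using k ni by simp
  qed
  have "I \<subseteq> {i}"
  proof
    fix j assume that: "j \<in> I"
    \<comment> \<open>With \<open>k = 1\<close>, two vertices suffice for the first vertex of path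
      \<open>j\<close> to have a sole neighbour.\<close>
    have nj: "n j \<ge> k + 1" using n2[OF that] k1 by simp
    show "j \<in> {i}" using eq[OF that _ first[OF nj] i _ first[OF ni]] ni nj by simp
  qed
  then have "I = {i}" using i by blast
  then show ?thesis using nik k1 by simp
qed

lemma P3_magic:
  assumes "n i = 3"
  shows "k_distance_magic 1 (path_union {i} n)"
proof -
  \<comment> \<open>The labels along the path are 1, 3, 2: each end sees the centre's 3, and the
    centre sees 1 + 2 = 3.\<close>
  let ?f = "\<lambda>(j, a). if a = 2 then 3 else if a = 3 then 2 else (1::nat)"
  have set3: "{1..3::nat} = {1, 2, 3}" by auto
  have verts: "pverts (path_union {i} n) = {(i, 1), (i, 2), (i, 3)}"
    using assms by (auto simp: pverts_path_union set3)
  have nb: "dist_nbhd (path_union {i} n) 1 (i, 1) = {(i, 2)}"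
    "dist_nbhd (path_union {i} n) 1 (i, 2) = {(i, 1), (i, 3)}"
    "dist_nbhd (path_union {i} n) 1 (i, 3) = {(i, 2)}"
    using assms by (auto simp: dist_nbhd_path_union)
  have dist: "graph_dist (path_union {i} n) (i, 1) (i, 2) = ereal (real 1)"
    using assms by (subst graph_dist_path_union_eq_iff) auto
  have card: "card (pverts (path_union {i} n)) = 3"
    by (simp add: verts)
  have "bij_betw ?f (pverts (path_union {i} n)) {1..3}"
    unfolding verts set3 by (auto simp: bij_betw_def inj_on_def)
  then have "k_distance_magic_labeling 1 (path_union {i} n) ?f 3"
    unfolding k_distance_magic_labeling_def card
    using dist by (auto simp: verts nb simp del: One_nat_def)
  then show ?thesis by (auto simp: k_distance_magic_def)
qed

theorem theorem2p2:
  fixes m k :: nat and n :: "nat \<Rightarrow> nat"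
  assumes "\<And>i. i \<in> {1..m} \<Longrightarrow> n i \<ge> 2"
  shows "k_distance_magic k (disjoint_union {1..m} (\<lambda>i. path_graph (n i)))
    \<longleftrightarrow> (\<forall>i\<in>{1..m}. n i = 3) \<and> m = 1 \<and> k = 1"
proof
  assume "k_distance_magic k (path_union {1..m} n)"
  then obtain f M where "k_distance_magic_labeling k (path_union {1..m} n) f M"
    by (auto simp: k_distance_magic_def)
  from path_union_magic_imp[OF finite_atLeastAtMost assms this]
  obtain i where k: "k = 1" and i: "{1..m} = {i}" "n i = 3" by blast
  moreover have "m = 1" using arg_cong[OF i(1), of card] by simp
  ultimately show "(\<forall>i\<in>{1..m}. n i = 3) \<and> m = 1 \<and> k = 1" using k by simp
next
  assume "(\<forall>i\<in>{1..m}. n i = 3) \<and> m = 1 \<and> k = 1"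
  then show "k_distance_magic k (path_union {1..m} n)"
    using P3_magic[of n 1] by simp
qed

end
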